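(* Let $A$ be a nilpotent algebra over a field $\mathbb{F}$, and let $\circ$ be the binary operation on $A$ given by $$a\circ b=a+b+f(a,b),$$ where $f(x,y)$ is a polynomial with coefficients in $A$ that does not contain the monomials $x$ and $y$ with coefficients from $\mathbb{F}$ (i.e. $f$ has zero linear part). Then $\circ$ makes $A$ a quasigroup: for any $a,b,c\in A$ each of the equations $a\circ y=c$ and $x\circ b=c$ has a unique solution in $A$.
   Context: An algebra over $\mathbb{F}$ is a vector space with a bilinear multiplication, not assumed associative, Lie, commutative or unital. $A$ is nilpotent of class $\le c$ if every product (with any bracketing) of $c+1$ elements of $A$ is zero. Let $\mathcal{F}(x,y)$ be the absolutely free nonassociative (non-unital) algebra on $x,y$. A polynomial with coefficients in $A$ is an element $f$ of the free product $\mathcal{F}(x,y)*A$ of nonassociative algebras (for example $a+bx+(yc)x+xy$ with $a,b,c\in A$); its value $f(a_1,a_2)$ is the image of $f$ under the homomorphism to $A$ that is the identity on $A$ and sends $x\mapsto a_1$, $y\mapsto a_2$. The homomorphism $\mathcal{F}(x,y)*A\to\mathcal{F}(x,y)$ sending $A$ to $0$ and fixing $x,y$ sends $f$ to an element whose degree-one part $\lambda x+\mu y$ ($\lambda,\mu\in\mathbb{F}$) is the linear part of $f$. *)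

theory Defs
  imports Complex_Main "HOL-Library.Poly_Mapping"
begin

section \<open>Nonassociative algebras\<close>

locale nonassoc_algebra = vector_space scale
  for scale :: "'k::field \<Rightarrow> 'a::ab_group_add \<Rightarrow> 'a" +
  fixes mult :: "'a \<Rightarrow> 'a \<Rightarrow> 'a"
  assumes mult_add_left: "mult (a + b) c = mult a c + mult b c"
    and mult_add_right: "mult a (b + c) = mult a b + mult a c"
    and mult_scale_left: "mult (scale r a) b = scale r (mult a b)"
    and mult_scale_right: "mult a (scale r b) = scale r (mult a b)"

locale algebra_hom =
  A: nonassoc_algebra scaleA multA + B: nonassoc_algebra scaleB multB +
  module_hom scaleA scaleB h
  for scaleA :: "'k::field \<Rightarrow> 'a::ab_group_add \<Rightarrow> 'a" and multA :: "'a \<Rightarrow> 'a \<Rightarrow> 'a"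
    and scaleB :: "'k \<Rightarrow> 'b::ab_group_add \<Rightarrow> 'b" and multB :: "'b \<Rightarrow> 'b \<Rightarrow> 'b"
    and h :: "'a \<Rightarrow> 'b" +
  assumes hom_mult: "h (multA a b) = multB (h a) (h b)"

definition algebra_ideal ::
  "('k::field \<Rightarrow> 'a::ab_group_add \<Rightarrow> 'a) \<Rightarrow> ('a \<Rightarrow> 'a \<Rightarrow> 'a) \<Rightarrow> 'a set \<Rightarrow> bool" where
  "algebra_ideal scale mult I \<longleftrightarrow>
     module.subspace scale I \<and> (\<forall>a. \<forall>i\<in>I. mult a i \<in> I \<and> mult i a \<in> I)"

text \<open>Bracketed words over \<open>'g\<close>, i.e. the free magma. A bracketed word over the elements
  of an algebra encodes a product together with its bracketing.\<close>

datatype 'g magma = Gen 'g | Prod "'g magma" "'g magma"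

primrec word_length :: "'g magma \<Rightarrow> nat" where
  "word_length (Gen g) = 1"
| "word_length (Prod t u) = word_length t + word_length u"

primrec magma_eval :: "('a \<Rightarrow> 'a \<Rightarrow> 'a) \<Rightarrow> ('g \<Rightarrow> 'a) \<Rightarrow> 'g magma \<Rightarrow> 'a" where
  "magma_eval mult g (Gen x) = g x"
| "magma_eval mult g (Prod t u) = mult (magma_eval mult g t) (magma_eval mult g u)"

definition nilpotent_class_le :: "('a::zero \<Rightarrow> 'a \<Rightarrow> 'a) \<Rightarrow> nat \<Rightarrow> bool" where
  "nilpotent_class_le mult c \<longleftrightarrow>
     (\<forall>w :: 'a magma. word_length w = c + 1 \<longrightarrow> magma_eval mult id w = 0)"

definition nilpotent_algebra :: "('a::zero \<Rightarrow> 'a \<Rightarrow> 'a) \<Rightarrow> bool" where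
  "nilpotent_algebra mult \<longleftrightarrow> (\<exists>c. nilpotent_class_le mult c)"


section \<open>The absolutely free nonassociative algebra\<close>

text \<open>The underlying space consists of the finitely supported functions on the free magma.\<close>

type_synonym ('g, 'k) free_algebra = "'g magma \<Rightarrow>\<^sub>0 'k"

definition free_scale :: "'k::field \<Rightarrow> ('g, 'k) free_algebra \<Rightarrow> ('g, 'k) free_algebra" where
  "free_scale c = Poly_Mapping.map ((*) c)"

definition free_mult ::
  "('g, 'k::field) free_algebra \<Rightarrow> ('g, 'k) free_algebra \<Rightarrow> ('g, 'k) free_algebra" where
  "free_mult p q =
     (\<Sum>t\<in>Poly_Mapping.keys p. \<Sum>u\<in>Poly_Mapping.keys q.
        Poly_Mapping.single (Prod t u) (Poly_Mapping.lookup p t * Poly_Mapping.lookup q u))"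

definition free_gen :: "'g \<Rightarrow> ('g, 'k::field) free_algebra" where
  "free_gen x = Poly_Mapping.single (Gen x) 1"

text \<open>The homomorphism from the free algebra determined by its values \<open>g\<close> on the generators
  (see \<open>free_lift_hom\<close> and \<open>free_lift_unique\<close> below).\<close>

definition free_lift ::
  "('k::field \<Rightarrow> 'a::ab_group_add \<Rightarrow> 'a) \<Rightarrow> ('a \<Rightarrow> 'a \<Rightarrow> 'a) \<Rightarrow> ('g \<Rightarrow> 'a)
     \<Rightarrow> ('g, 'k) free_algebra \<Rightarrow> 'a" where
  "free_lift scale mult g p =
     (\<Sum>t\<in>Poly_Mapping.keys p. scale (Poly_Mapping.lookup p t) (magma_eval mult g t))"

definition homogeneous_part ::
  "nat \<Rightarrow> ('g, 'k::field) free_algebra \<Rightarrow> ('g, 'k) free_algebra" where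
  "homogeneous_part d p =
     (\<Sum>t \<in> {t \<in> Poly_Mapping.keys p. word_length t = d}.
        Poly_Mapping.single t (Poly_Mapping.lookup p t))"


section \<open>The free product of two nonassociative algebras\<close>

text \<open>The free product \<open>A * B\<close> is the free algebra on the disjoint union of \<open>A\<close> and \<open>B\<close>, modulo
  the ideal generated by the relations saying that the two inclusions are homomorphisms.
  Its elements are cosets of that ideal.\<close>

definition hom_relations ::
  "('k::field \<Rightarrow> 'a::ab_group_add \<Rightarrow> 'a) \<Rightarrow> ('a \<Rightarrow> 'a \<Rightarrow> 'a) \<Rightarrow> ('a \<Rightarrow> 'g)
     \<Rightarrow> ('g, 'k) free_algebra set" where
  "hom_relations scale mult \<iota> =
     {free_gen (\<iota> (a + b)) - (free_gen (\<iota> a) + free_gen (\<iota> b)) | a b. True}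
   \<union> {free_gen (\<iota> (scale r a)) - free_scale r (free_gen (\<iota> a)) | r a. True}
   \<union> {free_gen (\<iota> (mult a b)) - free_mult (free_gen (\<iota> a)) (free_gen (\<iota> b)) | a b. True}"

definition free_product_ideal ::
  "('k::field \<Rightarrow> 'a::ab_group_add \<Rightarrow> 'a) \<Rightarrow> ('a \<Rightarrow> 'a \<Rightarrow> 'a)
     \<Rightarrow> ('k \<Rightarrow> 'b::ab_group_add \<Rightarrow> 'b) \<Rightarrow> ('b \<Rightarrow> 'b \<Rightarrow> 'b)
     \<Rightarrow> ('a + 'b, 'k) free_algebra set" where
  "free_product_ideal scaleA multA scaleB multB =
     algebra_ideal free_scale free_mult hull
       (hom_relations scaleA multA Inl \<union> hom_relations scaleB multB Inr)"

definition free_product_rel ::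
  "('k::field \<Rightarrow> 'a::ab_group_add \<Rightarrow> 'a) \<Rightarrow> ('a \<Rightarrow> 'a \<Rightarrow> 'a)
     \<Rightarrow> ('k \<Rightarrow> 'b::ab_group_add \<Rightarrow> 'b) \<Rightarrow> ('b \<Rightarrow> 'b \<Rightarrow> 'b)
     \<Rightarrow> ('a + 'b, 'k) free_algebra rel" where
  "free_product_rel scaleA multA scaleB multB =
     {(p, q). p - q \<in> free_product_ideal scaleA multA scaleB multB}"

definition free_product ::
  "('k::field \<Rightarrow> 'a::ab_group_add \<Rightarrow> 'a) \<Rightarrow> ('a \<Rightarrow> 'a \<Rightarrow> 'a)
     \<Rightarrow> ('k \<Rightarrow> 'b::ab_group_add \<Rightarrow> 'b) \<Rightarrow> ('b \<Rightarrow> 'b \<Rightarrow> 'b)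
     \<Rightarrow> ('a + 'b, 'k) free_algebra set set" where
  "free_product scaleA multA scaleB multB =
     UNIV // free_product_rel scaleA multA scaleB multB"

text \<open>The homomorphism from \<open>A * B\<close> to \<open>C\<close> induced by homomorphisms \<open>\<phi>\<close> from \<open>A\<close> and \<open>\<psi>\<close> from \<open>B\<close>:
  the common value on a coset of the corresponding homomorphism on the free algebra
  (see \<open>free_product_lift_class\<close> below).\<close>

definition free_product_lift ::
  "('k::field \<Rightarrow> 'c::ab_group_add \<Rightarrow> 'c) \<Rightarrow> ('c \<Rightarrow> 'c \<Rightarrow> 'c) \<Rightarrow> ('a \<Rightarrow> 'c) \<Rightarrow> ('b \<Rightarrow> 'c)
     \<Rightarrow> ('a + 'b, 'k) free_algebra set \<Rightarrow> 'c" where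
  "free_product_lift scale mult \<phi> \<psi> f = the_elem (free_lift scale mult (case_sum \<phi> \<psi>) ` f)"


section \<open>Polynomials in two variables with coefficients in an algebra\<close>

datatype variable = X | Y

definition polynomials ::
  "('k::field \<Rightarrow> 'a::ab_group_add \<Rightarrow> 'a) \<Rightarrow> ('a \<Rightarrow> 'a \<Rightarrow> 'a)
     \<Rightarrow> ((variable, 'k) free_algebra + 'a, 'k) free_algebra set set" where
  "polynomials scale mult = free_product free_scale free_mult scale mult"

definition poly_value ::
  "('k::field \<Rightarrow> 'a::ab_group_add \<Rightarrow> 'a) \<Rightarrow> ('a \<Rightarrow> 'a \<Rightarrow> 'a)
     \<Rightarrow> ((variable, 'k) free_algebra + 'a, 'k) free_algebra set \<Rightarrow> 'a \<Rightarrow> 'a \<Rightarrow> 'a" where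
  "poly_value scale mult f a\<^sub>1 a\<^sub>2 =
     free_product_lift scale mult (free_lift scale mult (case_variable a\<^sub>1 a\<^sub>2)) id f"

definition linear_part ::
  "((variable, 'k::field) free_algebra + 'a, 'k) free_algebra set
     \<Rightarrow> (variable, 'k) free_algebra" where
  "linear_part f =
     homogeneous_part 1 (free_product_lift free_scale free_mult id (\<lambda>_. 0) f)"


section \<open>The constructions have their universal properties\<close>

lemma lookup_free_scale [simp]:
  "Poly_Mapping.lookup (free_scale c p) t = c * Poly_Mapping.lookup p t"
  unfolding free_scale_def by (simp add: Poly_Mapping.map.rep_eq when_def)

lemma free_scale_single [simp]:
  "free_scale c (Poly_Mapping.single t d) = Poly_Mapping.single t (c * d)"
  by (rule poly_mapping_eqI) (simp add: lookup_single when_def)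

lemma vector_space_free: "vector_space (free_scale :: 'k::field \<Rightarrow> ('g, 'k) free_algebra \<Rightarrow> _)"
  by unfold_locales (auto intro!: poly_mapping_eqI simp: lookup_add algebra_simps)

lemma free_algebra_eq_sum:
  "p = (\<Sum>t\<in>Poly_Mapping.keys p. Poly_Mapping.single t (Poly_Mapping.lookup p t))"
  by (rule poly_mapping_eqI)
    (simp add: lookup_sum lookup_single when_def in_keys_iff)

lemma free_mult_superset:
  assumes "finite S" "Poly_Mapping.keys p \<subseteq> S" "finite T" "Poly_Mapping.keys q \<subseteq> T"
  shows "free_mult p q = (\<Sum>t\<in>S. \<Sum>u\<in>T.
    Poly_Mapping.single (Prod t u) (Poly_Mapping.lookup p t * Poly_Mapping.lookup q u))"
proof -
  have inner: "(\<Sum>u\<in>Poly_Mapping.keys q.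
      Poly_Mapping.single (Prod t u) (Poly_Mapping.lookup p t * Poly_Mapping.lookup q u)) =
    (\<Sum>u\<in>T. Poly_Mapping.single (Prod t u) (Poly_Mapping.lookup p t * Poly_Mapping.lookup q u))"
    for t
    by (rule sum.mono_neutral_left) (use assms in \<open>auto simp: in_keys_iff\<close>)
  show ?thesis
    unfolding free_mult_def inner
    by (rule sum.mono_neutral_left) (use assms in \<open>auto simp: in_keys_iff\<close>)
qed

lemma free_mult_single [simp]:
  "free_mult (Poly_Mapping.single t c) (Poly_Mapping.single u d) =
     Poly_Mapping.single (Prod t u) (c * d)"
  by (subst free_mult_superset[of "{t}" _ "{u}"]) auto

lemma lookup_free_mult:
  "Poly_Mapping.lookup (free_mult p q) w =
     (case w of Gen _ \<Rightarrow> 0 | Prod t u \<Rightarrow> Poly_Mapping.lookup p t * Poly_Mapping.lookup q u)"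
proof (cases w)
  case (Gen g)
  then show ?thesis by (simp add: free_mult_def lookup_sum lookup_single)
next
  case (Prod t u)
  have "free_mult p q = (\<Sum>t'\<in>insert t (Poly_Mapping.keys p). \<Sum>u'\<in>insert u (Poly_Mapping.keys q).
    Poly_Mapping.single (Prod t' u') (Poly_Mapping.lookup p t' * Poly_Mapping.lookup q u'))"
    by (rule free_mult_superset) auto
  moreover have "(\<Sum>u'\<in>insert u (Poly_Mapping.keys q). c * Poly_Mapping.lookup q u' when t' = t \<and> u' = u) =
      (c * Poly_Mapping.lookup q u when t' = t)" for t' c
    by (cases "t' = t")
      (simp_all add: when_def sum.delta[OF finite_insert[THEN iffD2, OF finite_keys]] del: sum.insert)
  moreover have "(\<Sum>t'\<in>insert t (Poly_Mapping.keys p). Poly_Mapping.lookup p t' * c when t' = t) =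
      Poly_Mapping.lookup p t * c" for c
    by (simp add: when_def sum.delta[OF finite_insert[THEN iffD2, OF finite_keys]] del: sum.insert)
  ultimately show ?thesis
    using Prod by (simp add: lookup_sum lookup_single del: sum.insert)
qed

lemma nonassoc_algebra_free:
  "nonassoc_algebra (free_scale :: 'k::field \<Rightarrow> ('g, 'k) free_algebra \<Rightarrow> _) free_mult"
proof -
  interpret vector_space "free_scale :: 'k \<Rightarrow> ('g, 'k) free_algebra \<Rightarrow> _"
    by (rule vector_space_free)
  show ?thesis
    by unfold_locales
      (auto intro!: poly_mapping_eqI simp: lookup_free_mult lookup_add algebra_simps split: magma.split)
qed

lemma free_lift_superset:
  assumes "nonassoc_algebra scale mult" "finite S" "Poly_Mapping.keys p \<subseteq> S"
  shows "free_lift scale mult g p =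
    (\<Sum>t\<in>S. scale (Poly_Mapping.lookup p t) (magma_eval mult g t))"
proof -
  interpret nonassoc_algebra scale mult by fact
  show ?thesis unfolding free_lift_def
    by (rule sum.mono_neutral_left) (use assms in \<open>auto simp: in_keys_iff\<close>)
qed

lemma free_lift_single:
  assumes "nonassoc_algebra scale mult"
  shows "free_lift scale mult g (Poly_Mapping.single t c) = scale c (magma_eval mult g t)"
  using free_lift_superset[OF assms, of "{t}" "Poly_Mapping.single t c"] by simp

lemma free_lift_gen:
  assumes "nonassoc_algebra scale mult"
  shows "free_lift scale mult g (free_gen x) = g x"
proof -
  interpret nonassoc_algebra scale mult by fact
  show ?thesis by (simp add: free_gen_def free_lift_single[OF assms])
qed

lemma free_lift_module_hom:
  assumes "nonassoc_algebra scale mult"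
  shows "module_hom free_scale scale (free_lift scale mult g)"
proof -
  interpret nonassoc_algebra scale mult by fact
  interpret F: vector_space "free_scale :: _ \<Rightarrow> ('c, 'a) free_algebra \<Rightarrow> _"
    by (rule vector_space_free)
  show ?thesis
  proof unfold_locales
    fix p q :: "('c, 'a) free_algebra"
    let ?S = "Poly_Mapping.keys p \<union> Poly_Mapping.keys q"
    have "free_lift scale mult g (p + q) = (\<Sum>t\<in>?S. scale (Poly_Mapping.lookup (p + q) t) (magma_eval mult g t))"
      by (rule free_lift_superset[OF assms]) (use Poly_Mapping.keys_add[of p q] in auto)
    then show "free_lift scale mult g (p + q) = free_lift scale mult g p + free_lift scale mult g q"
      by (simp add: free_lift_superset[OF assms, of ?S] lookup_add scale_left_distrib sum.distrib)
  next
    fix r and p :: "('c, 'a) free_algebra"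
    have "free_lift scale mult g (free_scale r p) =
      (\<Sum>t\<in>Poly_Mapping.keys p. scale (Poly_Mapping.lookup (free_scale r p) t) (magma_eval mult g t))"
      by (rule free_lift_superset[OF assms]) (auto simp: in_keys_iff)
    then show "free_lift scale mult g (free_scale r p) = scale r (free_lift scale mult g p)"
      by (simp add: free_lift_def scale_sum_right)
  qed
qed

lemma free_lift_hom:
  assumes "nonassoc_algebra scale mult"
  shows "algebra_hom free_scale free_mult scale mult (free_lift scale mult g)"
proof -
  interpret nonassoc_algebra scale mult by fact
  interpret F: nonassoc_algebra "free_scale :: _ \<Rightarrow> ('c, 'a) free_algebra \<Rightarrow> _" free_mult
    by (rule nonassoc_algebra_free)
  interpret h: module_hom free_scale scale "free_lift scale mult g"
    by (rule free_lift_module_hom[OF assms])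
  interpret l: module_hom scale scale "\<lambda>a. mult a b" for b
    by unfold_locales (auto simp: mult_add_left mult_scale_left)
  interpret r: module_hom scale scale "mult a" for a
    by unfold_locales (auto simp: mult_add_right mult_scale_right)
  show ?thesis
  proof unfold_locales
    fix p q :: "('c, 'a) free_algebra"
    show "free_lift scale mult g (free_mult p q) = mult (free_lift scale mult g p) (free_lift scale mult g q)"
      unfolding free_mult_def h.sum free_lift_single[OF assms]
      by (simp only: free_lift_def l.sum r.sum mult_scale_left mult_scale_right
          magma_eval.simps scale_scale mult.commute scale_sum_right) (rule sum.swap)
  qed
qed

lemma free_lift_unique:
  assumes "algebra_hom free_scale free_mult scale mult h" "\<And>x. h (free_gen x) = g x"
  shows "h = free_lift scale mult g"
proof
  interpret algebra_hom free_scale free_mult scale mult h by fact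
  have word: "h (Poly_Mapping.single t 1) = magma_eval mult g t" for t
  proof (induction t)
    case (Gen x)
    then show ?case using assms(2)[of x] by (simp add: free_gen_def)
  next
    case (Prod t u)
    then show ?case
      using hom_mult[of "Poly_Mapping.single t 1" "Poly_Mapping.single u 1"] by simp
  qed
  fix p
  have "h p = h (\<Sum>t\<in>Poly_Mapping.keys p.
      free_scale (Poly_Mapping.lookup p t) (Poly_Mapping.single t 1))"
    using free_algebra_eq_sum[of p] by simp
  also have "\<dots> = free_lift scale mult g p"
    unfolding sum scale word free_lift_def ..
  finally show "h p = free_lift scale mult g p" .
qed

lemma algebra_ideal_ideal_hull:
  assumes "nonassoc_algebra scale mult"
  shows "algebra_ideal scale mult (algebra_ideal scale mult hull S)"
proof -
  interpret nonassoc_algebra scale mult by fact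
  show ?thesis
    by (rule hull_in) (auto simp: algebra_ideal_def subspace_def)
qed

lemma equiv_free_product_rel:
  fixes scaleA :: "'k::field \<Rightarrow> 'a::ab_group_add \<Rightarrow> 'a" and scaleB :: "'k \<Rightarrow> 'b::ab_group_add \<Rightarrow> 'b"
  shows "equiv UNIV (free_product_rel scaleA multA scaleB multB)"
proof -
  interpret nonassoc_algebra "free_scale :: 'k \<Rightarrow> ('a + 'b, 'k) free_algebra \<Rightarrow> _" free_mult
    by (rule nonassoc_algebra_free)
  let ?I = "free_product_ideal scaleA multA scaleB multB"
  have I: "subspace ?I"
    using algebra_ideal_ideal_hull[OF nonassoc_algebra_free]
    unfolding free_product_ideal_def algebra_ideal_def by blast
  show ?thesis
  proof (rule equivI)
    show "refl (free_product_rel scaleA multA scaleB multB)"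
      using subspace_0[OF I] by (auto simp: refl_on_def free_product_rel_def)
    show "sym (free_product_rel scaleA multA scaleB multB)"
      using subspace_neg[OF I] by (force simp: sym_def free_product_rel_def)
    show "trans (free_product_rel scaleA multA scaleB multB)"
    proof (rule transI)
      fix p q r
      assume "(p, q) \<in> free_product_rel scaleA multA scaleB multB"
        "(q, r) \<in> free_product_rel scaleA multA scaleB multB"
      then show "(p, r) \<in> free_product_rel scaleA multA scaleB multB"
        using subspace_add[OF I, of "p - q" "q - r"] by (simp add: free_product_rel_def)
    qed
  qed auto
qed

lemma free_lift_free_product_ideal:
  assumes \<phi>: "algebra_hom scaleA multA scale mult \<phi>" and \<psi>: "algebra_hom scaleB multB scale mult \<psi>"
    and p: "p \<in> free_product_ideal scaleA multA scaleB multB"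
  shows "free_lift scale mult (case_sum \<phi> \<psi>) p = 0"
proof -
  interpret \<phi>: algebra_hom scaleA multA scale mult \<phi> by fact
  interpret \<psi>: algebra_hom scaleB multB scale mult \<psi> by fact
  note alg = \<phi>.B.nonassoc_algebra_axioms
  interpret h: algebra_hom free_scale free_mult scale mult "free_lift scale mult (case_sum \<phi> \<psi>)"
    by (rule free_lift_hom[OF alg])
  have zero: "mult 0 a = 0" "mult a 0 = 0" for a
    using \<phi>.B.mult_add_left[of 0 0 a] \<phi>.B.mult_add_right[of a 0 0] by auto
  note gen = free_lift_gen[OF alg]
  show ?thesis
    using p unfolding free_product_ideal_def
  proof (rule hull_induct)
    show "free_lift scale mult (case_sum \<phi> \<psi>) r = 0"
      if "r \<in> hom_relations scaleA multA Inl \<union> hom_relations scaleB multB Inr" for r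
      using that
      by (auto simp: hom_relations_def h.diff h.add h.scale h.hom_mult gen
          \<phi>.add \<phi>.scale \<phi>.hom_mult \<psi>.add \<psi>.scale \<psi>.hom_mult)
    show "algebra_ideal free_scale free_mult {p. free_lift scale mult (case_sum \<phi> \<psi>) p = 0}"
      by (auto simp: algebra_ideal_def h.A.subspace_def h.add h.scale h.hom_mult zero)
  qed
qed

lemma free_product_lift_class:
  assumes "algebra_hom scaleA multA scale mult \<phi>" "algebra_hom scaleB multB scale mult \<psi>"
  shows "free_product_lift scale mult \<phi> \<psi> (free_product_rel scaleA multA scaleB multB `` {p}) =
    free_lift scale mult (case_sum \<phi> \<psi>) p"
proof -
  interpret \<phi>: algebra_hom scaleA multA scale mult \<phi> by fact
  let ?h = "free_lift scale mult (case_sum \<phi> \<psi>)"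
  let ?C = "free_product_rel scaleA multA scaleB multB `` {p}"
  interpret h: algebra_hom free_scale free_mult scale mult ?h
    by (rule free_lift_hom[OF \<phi>.B.nonassoc_algebra_axioms])
  have "?h q = ?h p" if "q \<in> ?C" for q
    using free_lift_free_product_ideal[OF assms, of "p - q"] that
    by (simp add: free_product_rel_def h.diff)
  moreover have "p \<in> ?C"
    using equiv_class_self[OF equiv_free_product_rel] by blast
  ultimately have "?h ` ?C = {?h p}" by blast
  then show ?thesis by (simp add: free_product_lift_def)
qed

lemma poly_value_class:
  assumes "nonassoc_algebra scale mult"
  shows "poly_value scale mult (free_product_rel free_scale free_mult scale mult `` {p}) a\<^sub>1 a\<^sub>2 =
    free_lift scale mult (case_sum (free_lift scale mult (case_variable a\<^sub>1 a\<^sub>2)) id) p"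
proof -
  interpret nonassoc_algebra scale mult by fact
  have "algebra_hom scale mult scale mult id"
    by unfold_locales auto
  then show ?thesis
    unfolding poly_value_def
    by (rule free_product_lift_class[OF free_lift_hom[OF assms]])
qed

lemma linear_part_class:
  assumes "nonassoc_algebra scale mult"
  shows "linear_part (free_product_rel free_scale free_mult scale mult `` {p}) =
    homogeneous_part 1 (free_lift free_scale free_mult (case_sum id (\<lambda>_. 0)) p)"
proof -
  interpret nonassoc_algebra scale mult by fact
  interpret F: nonassoc_algebra "free_scale :: 'a \<Rightarrow> (variable, 'a) free_algebra \<Rightarrow> _" free_mult
    by (rule nonassoc_algebra_free)
  have "algebra_hom free_scale free_mult free_scale free_mult (id :: (variable, 'a) free_algebra \<Rightarrow> _)"
    by unfold_locales auto
  moreover have "algebra_hom scale mult free_scale free_mult (\<lambda>_. 0 :: (variable, 'a) free_algebra)"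
    by unfold_locales (auto simp: free_mult_def)
  ultimately show ?thesis
    unfolding linear_part_def by (subst free_product_lift_class) auto
qed

end

(* Let S n be the span of all products of n + 1 elements, a descending chain of ideals that reaches 0.
   A product of at least two factors maps elements congruent mod S n to elements congruent
   mod S (n + 1), so when f has no linear part the map y -> c - a - f(a, y) is a contraction with
   respect to this filtration. It therefore has exactly one fixed point, which is the solution of
   a o y = c; the other equation is symmetric. *)
theory Submission
  imports Defs
begin

context nonassoc_algebra
begin

text \<open>The index is shifted by one: \<open>power_span 0\<close> is the whole algebra, and class
  at most \<open>c\<close> means that \<open>power_span c\<close> vanishes.\<close>

definition power_span :: "nat \<Rightarrow> 'a set" where
  "power_span n = span {magma_eval mult id w | w. word_length w = Suc n}"

lemma subspace_power_span: "subspace (power_span n)"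
  unfolding power_span_def by (rule subspace_span)

lemma power_span_0: "x \<in> power_span 0"
  unfolding power_span_def by (rule span_base) (auto intro!: exI[of _ "Gen x"])

lemma nilpotent_power_span_eq_0:
  assumes "nilpotent_class_le mult c" "x \<in> power_span c"
  shows "x = 0"
proof -
  have "{magma_eval mult id w | w. word_length w = Suc c} \<subseteq> {0}"
    using assms(1) by (auto simp: nilpotent_class_le_def)
  then have "power_span c \<subseteq> span {0}"
    unfolding power_span_def by (rule span_mono)
  then show ?thesis using assms(2) by auto
qed

text \<open>Multiplication by \<open>y\<close> is linear and lengthens each spanning word by one
  letter, since every element of the algebra may serve as a letter.\<close>

lemma power_span_mult:
  assumes "x \<in> power_span n"
  shows "mult x y \<in> power_span (Suc n)" and "mult y x \<in> power_span (Suc n)"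
proof -
  let ?W = "{magma_eval mult id w | w. word_length w = Suc n}"
  interpret l: module_hom scale scale "\<lambda>x. mult x y"
    by unfold_locales (auto simp: mult_add_left mult_scale_left)
  interpret r: module_hom scale scale "mult y"
    by unfold_locales (auto simp: mult_add_right mult_scale_right)
  have "(\<lambda>x. mult x y) ` ?W \<subseteq> {magma_eval mult id w | w. word_length w = Suc (Suc n)}"
  proof clarify
    fix w :: "'a magma" assume "word_length w = Suc n"
    then show "\<exists>v. mult (magma_eval mult id w) y = magma_eval mult id v \<and> word_length v = Suc (Suc n)"
      by (intro exI[of _ "Prod w (Gen y)"]) simp
  qed
  then have "(\<lambda>x. mult x y) ` power_span n \<subseteq> power_span (Suc n)"
    unfolding power_span_def l.span_image[symmetric] by (rule span_mono)
  then show "mult x y \<in> power_span (Suc n)" using assms by blast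
  have "mult y ` ?W \<subseteq> {magma_eval mult id w | w. word_length w = Suc (Suc n)}"
  proof clarify
    fix w :: "'a magma" assume "word_length w = Suc n"
    then show "\<exists>v. mult y (magma_eval mult id w) = magma_eval mult id v \<and> word_length v = Suc (Suc n)"
      by (intro exI[of _ "Prod (Gen y) w"]) simp
  qed
  then have "mult y ` power_span n \<subseteq> power_span (Suc n)"
    unfolding power_span_def r.span_image[symmetric] by (rule span_mono)
  then show "mult y x \<in> power_span (Suc n)" using assms by blast
qed

lemma word_length_pos: "word_length w > 0"
  by (induction w) auto

(* Evaluating one innermost product turns it into a single letter. *)
lemma collapse_word:
  assumes "word_length w = Suc (Suc n)"
  shows "\<exists>v. magma_eval mult id v = magma_eval mult id w \<and> word_length v = Suc n"
  using assms
proof (induction w arbitrary: n)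
  case (Gen x)
  then show ?case by simp
next
  case (Prod t u)
  \<comment> \<open>Either a factor has at least two letters and the induction hypothesis shortens
    it, or both factors are letters and their product becomes one letter.\<close>
  consider m where "word_length t = Suc (Suc m)" | m where "word_length u = Suc (Suc m)"
    | "word_length t = 1" "word_length u = 1"
    using word_length_pos[of t] word_length_pos[of u]
    by (metis One_nat_def gr0_implies_Suc not0_implies_Suc)
  then show ?case
  proof cases
    case (1 m)
    then obtain v where "magma_eval mult id v = magma_eval mult id t" "word_length v = Suc m"
      using Prod.IH(1) by blast
    then show ?thesis using 1 Prod.prems
      by (intro exI[of _ "Prod v u"]) (simp add: id_def)
  next
    case (2 m)
    then obtain v where "magma_eval mult id v = magma_eval mult id u" "word_length v = Suc m"
      using Prod.IH(2) by blast
    then show ?thesis using 2 Prod.prems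
      by (intro exI[of _ "Prod t v"]) (simp add: id_def)
  next
    case 3
    then show ?thesis using Prod.prems
      by (intro exI[of _ "Gen (magma_eval mult id (Prod t u))"]) (simp add: id_def)
  qed
qed

lemma power_span_Suc_subset: "power_span (Suc n) \<subseteq> power_span n"
  unfolding power_span_def 
  by (rule span_mono) (clarify, metis collapse_word)

text \<open>A Banach-type argument that stops after finitely many steps, because congruence modulo
  \<open>power_span c\<close> is already equality.\<close>

lemma contraction_unique_fixed_point:
  assumes nilpotent: "nilpotent_class_le mult c"
    and contraction: "\<And>n u v. u - v \<in> power_span n \<Longrightarrow> T u - T v \<in> power_span (Suc n)"
  shows "\<exists>!x. T x = x"
proof (rule ex_ex1I)
  \<comment> \<open>The gap between successive iterates starts in \<open>power_span 0\<close>, which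
    is everything, and sinks one level with each application of \<open>T\<close>.\<close>
  have "T ((T ^^ n) 0) - (T ^^ n) 0 \<in> power_span n" for n
  proof (induction n)
    case (Suc n)
    from contraction[OF this] show ?case by simp
  qed (rule power_span_0)
  then have "T ((T ^^ c) 0) = (T ^^ c) 0"
    using nilpotent_power_span_eq_0[OF nilpotent] by (metis eq_iff_diff_eq_0)
  then show "\<exists>x. T x = x" ..
next
  fix x y assume fixed: "T x = x" "T y = y"
  have "x - y \<in> power_span n" for n
  proof (induction n)
    case (Suc n)
    from contraction[OF this] show ?case using fixed by simp
  qed (rule power_span_0)
  then show "x = y"
    using nilpotent_power_span_eq_0[OF nilpotent] by (metis eq_iff_diff_eq_0)
qed

text \<open>With this target, taking the linear part is itself an algebra homomorphism, so the
  universal property of the free algebra applies to it.\<close>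

lemma nonassoc_algebra_null_mult: "nonassoc_algebra scale (\<lambda>_ _. 0)"
  by unfold_locales auto

(* Lifting along the zero multiplication extracts the linear part of p. *)
lemma free_lift_diff_cong:
  assumes diff: "\<And>x. g x - h x \<in> power_span n"
    and lin: "\<And>x. g x - h x - \<delta> x \<in> power_span (Suc n)"
  shows "free_lift scale mult g p - free_lift scale mult h p - free_lift scale (\<lambda>_ _. 0) \<delta> p
    \<in> power_span (Suc n)"
proof -
  let ?D = "\<lambda>t. magma_eval mult g t - magma_eval mult h t"
  have prod: "?D (Prod t u) \<in> power_span (Suc n)"
    if "?D t \<in> power_span n" "?D u \<in> power_span n" for t u
  proof -
    have sub: "mult (a - b) z = mult a z - mult b z" "mult z (a - b) = mult z a - mult z b" for a b z
      using mult_add_left[of "a - b" b z] mult_add_right[of z "a - b" b]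
      by (simp_all add: algebra_simps)
    \<comment> \<open>Changing one factor at a time leaves a difference as a factor of each summand,
      and multiplication pushes that difference one level deeper.\<close>
    have "?D (Prod t u) = mult (?D t) (magma_eval mult g u) + mult (magma_eval mult h t) (?D u)"
      by (simp add: sub)
    then show ?thesis
      using power_span_mult that subspace_add[OF subspace_power_span] by metis
  qed
  have word: "?D t \<in> power_span n" for t
  proof (induction t)
    case (Prod t u)
    then show ?case using prod power_span_Suc_subset by blast
  qed (use diff in simp)
  have "?D t - magma_eval (\<lambda>_ _. 0) \<delta> t \<in> power_span (Suc n)" for t
  proof (cases t)
    case (Prod t u)
    then show ?thesis using prod[OF word word, of t u] by simp
  qed (use lin in simp)
  then have "(\<Sum>t\<in>Poly_Mapping.keys p.
      scale (Poly_Mapping.lookup p t) (?D t - magma_eval (\<lambda>_ _. 0) \<delta> t)) \<in> power_span (Suc n)"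
    by (intro subspace_sum[OF subspace_power_span] subspace_scale[OF subspace_power_span])
  then show ?thesis
    by (simp add: free_lift_def scale_right_diff_distrib sum_subtractf)
qed

text \<open>Words of length at least two evaluate to 0, and the hypothesis removes the coefficients
  of the single letters.\<close>

lemma free_lift_null_mult_eq_0:
  assumes "homogeneous_part 1 p = 0"
  shows "free_lift scale (\<lambda>_ _. 0) \<delta> p = 0"
  unfolding free_lift_def
proof (rule sum.neutral, clarify)
  fix t assume t: "t \<in> Poly_Mapping.keys p"
  show "scale (Poly_Mapping.lookup p t) (magma_eval (\<lambda>_ _. 0) \<delta> t) = 0"
  proof (cases t)
    case (Gen x)
    have "Poly_Mapping.lookup (homogeneous_part 1 p) t = Poly_Mapping.lookup p t"
      using t Gen by (simp add: homogeneous_part_def lookup_sum lookup_single when_def)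
    then show ?thesis using assms by simp
  qed simp
qed

text \<open>Both sides are homomorphisms that agree on generators. This carries the hypothesis on
  \<open>linear_part\<close>, which concerns an image in the free algebra on the variables, over to
  a representative \<open>p\<close> of the coset.\<close>

lemma free_lift_null_mult_comp:
  "free_lift scale (\<lambda>_ _. 0) \<delta> (free_lift free_scale free_mult (case_sum id (\<lambda>_. 0)) p)
    = free_lift scale (\<lambda>_ _. 0) (case_sum (free_lift scale (\<lambda>_ _. 0) \<delta>) (\<lambda>_. 0)) p"
proof -
  note null = nonassoc_algebra_null_mult
  interpret inner: algebra_hom free_scale free_mult free_scale free_mult
    "free_lift free_scale free_mult (case_sum id (\<lambda>_. 0))"
    by (rule free_lift_hom[OF nonassoc_algebra_free])
  interpret outer: algebra_hom free_scale free_mult scale "\<lambda>_ _. 0"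
    "free_lift scale (\<lambda>_ _. 0) \<delta>"
    by (rule free_lift_hom[OF null])
  have "algebra_hom free_scale free_mult scale (\<lambda>_ _. 0)
    (\<lambda>p. free_lift scale (\<lambda>_ _. 0) \<delta> (free_lift free_scale free_mult (case_sum id (\<lambda>_. 0)) p))"
    by unfold_locales
      (simp_all add: inner.add outer.add inner.scale outer.scale inner.hom_mult outer.hom_mult)
  then have "(\<lambda>p. free_lift scale (\<lambda>_ _. 0) \<delta> (free_lift free_scale free_mult (case_sum id (\<lambda>_. 0)) p))
    = free_lift scale (\<lambda>_ _. 0) (case_sum (free_lift scale (\<lambda>_ _. 0) \<delta>) (\<lambda>_. 0))"
    by (rule free_lift_unique)
      (simp add: free_lift_gen[OF nonassoc_algebra_free] outer.zero split: sum.split)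
  then show ?thesis by (rule fun_cong)
qed

lemma poly_value_contraction:
  assumes f: "f \<in> polynomials scale mult" "linear_part f = 0"
    and diff: "a\<^sub>1 - b\<^sub>1 \<in> power_span n" "a\<^sub>2 - b\<^sub>2 \<in> power_span n"
  shows "poly_value scale mult f a\<^sub>1 a\<^sub>2 - poly_value scale mult f b\<^sub>1 b\<^sub>2 \<in> power_span (Suc n)"
proof -
  note alg = nonassoc_algebra_axioms
  obtain p where p: "f = free_product_rel free_scale free_mult scale mult `` {p}"
    using f(1) unfolding polynomials_def free_product_def by (auto elim: quotientE)
  let ?g = "free_lift scale mult (case_variable a\<^sub>1 a\<^sub>2)"
  let ?h = "free_lift scale mult (case_variable b\<^sub>1 b\<^sub>2)"
  define \<delta> where "\<delta> = case_variable (a\<^sub>1 - b\<^sub>1) (a\<^sub>2 - b\<^sub>2)"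
  let ?d = "free_lift scale (\<lambda>_ _. 0) \<delta>"
  \<comment> \<open>First use of the first-order estimate, on the free algebra in the two variables:
    there \<open>\<delta>\<close> is the exact increment of each generator.\<close>
  have lin: "?g q - ?h q - ?d q \<in> power_span (Suc n)" for q
    by (rule free_lift_diff_cong)
      (use diff subspace_0[OF subspace_power_span] in \<open>auto simp: \<delta>_def split: variable.split\<close>)
  have "?d q \<in> power_span n" for q
    unfolding free_lift_def
  proof (intro subspace_sum subspace_scale subspace_power_span)
    show "magma_eval (\<lambda>_ _. 0) \<delta> t \<in> power_span n" for t
      using diff subspace_0[OF subspace_power_span]
      by (cases t) (auto simp: \<delta>_def split: variable.split)
  qed
  then have "?g q - ?h q \<in> power_span n" for q
    using subspace_add[OF subspace_power_span, of "?g q - ?h q - ?d q" n "?d q"]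
      lin power_span_Suc_subset by auto
  \<comment> \<open>Second use, on the letters of \<open>p\<close>: an element of the free algebra
    changes by \<open>?d\<close> up to \<open>power_span (Suc n)\<close>, a coefficient from the
    algebra not at all.\<close>
  then have "free_lift scale mult (case_sum ?g id) p - free_lift scale mult (case_sum ?h id) p
      - free_lift scale (\<lambda>_ _. 0) (case_sum ?d (\<lambda>_. 0)) p \<in> power_span (Suc n)"
    by (intro free_lift_diff_cong)
      (use lin subspace_0[OF subspace_power_span] in \<open>auto split: sum.split\<close>)
  moreover have "free_lift scale (\<lambda>_ _. 0) (case_sum ?d (\<lambda>_. 0)) p = 0"
    using f(2) free_lift_null_mult_eq_0
    unfolding p linear_part_class[OF alg] free_lift_null_mult_comp[symmetric] by blast
  ultimately show ?thesis
    unfolding p poly_value_class[OF alg] by simp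
qed

end

theorem proposition1p5:
  fixes scale :: "'k::field \<Rightarrow> 'a::ab_group_add \<Rightarrow> 'a"
    and mult :: "'a \<Rightarrow> 'a \<Rightarrow> 'a"
    and f :: "((variable, 'k) free_algebra + 'a, 'k) free_algebra set"
    and circ :: "'a \<Rightarrow> 'a \<Rightarrow> 'a"
  assumes "nonassoc_algebra scale mult"
    and "nilpotent_algebra mult"
    and "f \<in> polynomials scale mult"
    and "linear_part f = 0"
    and "\<And>a b. circ a b = a + b + poly_value scale mult f a b"
  shows "\<forall>a b c. (\<exists>!y. circ a y = c) \<and> (\<exists>!x. circ x b = c)"
proof (intro allI conjI)
  interpret nonassoc_algebra scale mult by fact
  obtain m where m: "nilpotent_class_le mult m"
    using assms(2) by (auto simp: nilpotent_algebra_def)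
  let ?f = "poly_value scale mult f"
  have zero: "0 \<in> power_span n" for n
    by (rule subspace_0[OF subspace_power_span])
  have swap: "u - v \<in> power_span n \<Longrightarrow> v - u \<in> power_span n" for u v n
    using subspace_neg[OF subspace_power_span, of "u - v" n] by simp
  fix a b c
  have "\<exists>!y. c - a - ?f a y = y"
  proof (rule contraction_unique_fixed_point[OF m])
    fix n u v assume "u - v \<in> power_span n"
    \<comment> \<open>The order is reversed because \<open>?f\<close> enters the map with a minus
      sign; the common first argument contributes the difference 0.\<close>
    then have "?f a v - ?f a u \<in> power_span (Suc n)"
      by (intro poly_value_contraction[OF assms(3,4)]) (auto simp: zero swap)
    then show "c - a - ?f a u - (c - a - ?f a v) \<in> power_span (Suc n)" by simp
  qed
  moreover have "circ a y = c \<longleftrightarrow> c - a - ?f a y = y" for y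
    unfolding assms(5) by (auto simp: algebra_simps)
  ultimately show "\<exists>!y. circ a y = c" by simp
  have "\<exists>!x. c - b - ?f x b = x"
  proof (rule contraction_unique_fixed_point[OF m])
    fix n u v assume "u - v \<in> power_span n"
    then have "?f v b - ?f u b \<in> power_span (Suc n)"
      by (intro poly_value_contraction[OF assms(3,4)]) (auto simp: zero swap)
    then show "c - b - ?f u b - (c - b - ?f v b) \<in> power_span (Suc n)" by simp
  qed
  moreover have "circ x b = c \<longleftrightarrow> c - b - ?f x b = x" for x
    unfolding assms(5) by (auto simp: algebra_simps)
  ultimately show "\<exists>!x. circ x b = c" by simp
qed

end
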